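(* Let $n\ge2$ be an even integer, let $p\in(0,1)$, and let $M=\frac14n^3$. Then $$\omega\left(\mathbf{Dome}\bigl((n+1)^{p};\,M^{1-p}\bigr)\right)\le\log\bigl((n+1)^3+1\bigr)-h(p),$$ where $h(p)=-p\log(p)-(1-p)\log(1-p)$ and $\log=\log_2$.
   Context: All vector spaces are finite dimensional over $\mathbb{C}$. For a tensor $T\in V_1\otimes\cdots\otimes V_k$, the tensor rank $\mathrm{R}(T)$ is the least $r$ such that $T$ is a sum of $r$ tensors of the form $v_1\otimes\cdots\otimes v_k$. The border rank $\underline{\mathrm{R}}(T)$ is the least $r$ such that $T$ is a limit (Euclidean topology) of tensors of rank $r$. The Kronecker product $T\boxtimes S\in(V_1\otimes W_1)\otimes\cdots\otimes(V_k\otimes W_k)$ of $T\in V_1\otimes\cdots\otimes V_k$ and $S\in W_1\otimes\cdots\otimes W_k$ is $T\otimes S$ regrouped as a $k$-tensor. The asymptotic rank is $\lim_{N\to\infty}\mathrm{R}(T^{\boxtimes N})^{1/N}$ (the same value is obtained with $\underline{\mathrm{R}}$ in place of $\mathrm{R}$), and the exponent $\omega(T)$ is its base-2 logarithm. For integers $m,L$, the dome tensor (with three equal legs) is the 4-tensor $$\mathbf{Dome}(m;L)=\sum_{i_1,i_2,i_3=1}^{m}\ \sum_{\ell=1}^{L} e_{i_1,\ell}\otimes e_{i_2,\ell}\otimes e_{i_3,\ell}\otimes e_{i_1,i_2,i_3}\in\mathbb{C}^{mL}\otimes\mathbb{C}^{mL}\otimes\mathbb{C}^{mL}\otimes\mathbb{C}^{m^3},$$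 where the $e$'s denote basis vectors of the respective factors. It is the graph tensor on vertices $1,2,3,4$ with edges $\{1,4\},\{2,4\},\{3,4\}$ of weight $m$ and the hyperedge $\{1,2,3\}$ of weight $L$. It satisfies $\mathbf{Dome}(m;L)^{\boxtimes N}=\mathbf{Dome}(m^N;L^N)$ up to change of bases. Convention for non-integer weights: for nonnegative real weights, the statement $\omega(\mathbf{Dome}(m;L))\le\lambda$ means that $\underline{\mathrm{R}}(\mathbf{Dome}(m^N;L^N))\le2^{\lambda N+o(N)}$, where $N$ ranges over the positive integers for which $m^N$ and $L^N$ are integers. *)

theory Defs
  imports Complex_Main "HOL-Library.Landau_Symbols"
begin

text \<open>
  For a finite set \<open>A\<close>, the space \<open>\<complex>\<^sup>A\<close> is modelled by the functions vanishing outside \<open>A\<close>, and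
  the tensor product of four such spaces by their coefficient arrays, vanishing outside the box
  \<open>A \<times> B \<times> C \<times> D\<close>. The index sets are explicit because their sizes vary with the power \<open>N\<close> below.
\<close>

type_synonym ('a, 'b, 'c, 'd) tensor4 = "'a \<Rightarrow> 'b \<Rightarrow> 'c \<Rightarrow> 'd \<Rightarrow> complex"

definition vec_space :: "'a set \<Rightarrow> ('a \<Rightarrow> complex) set" where
  "vec_space A = {v. \<forall>i. i \<notin> A \<longrightarrow> v i = 0}"

definition tensor_space ::
  "'a set \<Rightarrow> 'b set \<Rightarrow> 'c set \<Rightarrow> 'd set \<Rightarrow> ('a, 'b, 'c, 'd) tensor4 set" where
  "tensor_space A B C D =
     {T. \<forall>a b c d. \<not> (a \<in> A \<and> b \<in> B \<and> c \<in> C \<and> d \<in> D) \<longrightarrow> T a b c d = 0}"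

definition basis_vec :: "'a \<Rightarrow> 'a \<Rightarrow> complex" where
  "basis_vec i = (\<lambda>j. if j = i then 1 else 0)"

definition pure_tensor ::
  "('a \<Rightarrow> complex) \<Rightarrow> ('b \<Rightarrow> complex) \<Rightarrow> ('c \<Rightarrow> complex) \<Rightarrow> ('d \<Rightarrow> complex)
    \<Rightarrow> ('a, 'b, 'c, 'd) tensor4" where
  "pure_tensor u v w x = (\<lambda>a b c d. u a * v b * w c * x d)"

text \<open>
  The rank is only meaningful for finite index sets and tensors in the corresponding space;
  otherwise the set of admissible \<open>r\<close> may be empty and \<open>LEAST\<close> is unspecified.
\<close>

definition tensor_rank ::
  "'a set \<Rightarrow> 'b set \<Rightarrow> 'c set \<Rightarrow> 'd set \<Rightarrow> ('a, 'b, 'c, 'd) tensor4 \<Rightarrow> nat" where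
  "tensor_rank A B C D T = (LEAST r. \<exists>u v w x.
     (\<forall>s<r. u s \<in> vec_space A \<and> v s \<in> vec_space B \<and> w s \<in> vec_space C \<and> x s \<in> vec_space D) \<and>
     T = (\<lambda>a b c d. \<Sum>s<r. pure_tensor (u s) (v s) (w s) (x s) a b c d))"

text \<open>
  On a space of arrays with finite support box, the Euclidean topology is that of entrywise
  convergence.
\<close>

definition border_rank ::
  "'a set \<Rightarrow> 'b set \<Rightarrow> 'c set \<Rightarrow> 'd set \<Rightarrow> ('a, 'b, 'c, 'd) tensor4 \<Rightarrow> nat" where
  "border_rank A B C D T = (LEAST r. \<exists>X.
     (\<forall>j::nat. X j \<in> tensor_space A B C D \<and> tensor_rank A B C D (X j) = r) \<and>
     (\<forall>a b c d. (\<lambda>j. X j a b c d) \<longlonglongrightarrow> T a b c d))"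

definition dome ::
  "nat \<Rightarrow> nat \<Rightarrow> (nat \<times> nat, nat \<times> nat, nat \<times> nat, nat \<times> nat \<times> nat) tensor4" where
  "dome m L = (\<lambda>a b c d.
     \<Sum>i1=1..m. \<Sum>i2=1..m. \<Sum>i3=1..m. \<Sum>l=1..L.
       pure_tensor (basis_vec (i1, l)) (basis_vec (i2, l)) (basis_vec (i3, l))
         (basis_vec (i1, i2, i3)) a b c d)"

definition dome_border_rank :: "nat \<Rightarrow> nat \<Rightarrow> nat" where
  "dome_border_rank m L =
     border_rank ({1..m} \<times> {1..L}) ({1..m} \<times> {1..L}) ({1..m} \<times> {1..L})
       ({1..m} \<times> {1..m} \<times> {1..m}) (dome m L)"

text \<open>
  \<open>dome_exponent_le m L e\<close> is the statement \<open>\<omega>(Dome(m; L)) \<le> e\<close> for nonnegative real weights: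
  the border rank of \<open>Dome(m\<^sup>N; L\<^sup>N)\<close> is at most \<open>2\<close> to the power \<open>e N + o(N)\<close>, where \<open>N\<close> ranges
  only over those positive integers for which both \<open>m\<^sup>N\<close> and \<open>L\<^sup>N\<close> are integers (\<open>a\<close> and \<open>b\<close>).
\<close>

definition dome_exponent_le :: "real \<Rightarrow> real \<Rightarrow> real \<Rightarrow> bool" where
  "dome_exponent_le m L e \<longleftrightarrow>
     (\<exists>f :: nat \<Rightarrow> real. f \<in> o(\<lambda>N. real N) \<and>
       (\<forall>N a b :: nat. N > 0 \<longrightarrow> real a = m ^ N \<longrightarrow> real b = L ^ N \<longrightarrow>
          real (dome_border_rank a b) \<le> 2 powr (e * real N + f N)))"

definition binary_entropy :: "real \<Rightarrow> real" where
  "binary_entropy p = - p * log 2 p - (1 - p) * log 2 (1 - p)"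

end

theory Submission
  imports Defs "HOL-Analysis.Function_Topology" "HOL-Real_Asymp.Real_Asymp"
begin

text \<open>
  The proof follows the pattern of Schoenhage's asymptotic sum inequality, applied to 4-tensors.
  Write \<open>q = n + 1\<close> and \<open>R = q\<^sup>3 + 1\<close>.

  The source of the bound is a degeneration: the direct sum of \<open>Dome(q; 1)\<close> and \<open>Dome(1; M)\<close> has
  border rank at most \<open>R\<close>, although already \<open>Dome(q; 1)\<close> has \<open>q\<^sup>3\<close> independent slices. In the obvious
  decomposition of \<open>Dome(q; 1)\<close> into \<open>q\<^sup>3\<close> pure tensors \<open>x\<^sub>i \<otimes> y\<^sub>j \<otimes> z\<^sub>k \<otimes> e\<^sub>i\<^sub>j\<^sub>k\<close>, the first three factors are
  perturbed by multiples of \<open>\<epsilon>\<close> and the fourth by a multiple of \<open>\<epsilon>\<^bsup>-3\<^esup>\<close>. One further pure tensor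
  removes the leading term, the perturbations are chosen such that the next two orders
  vanish, and the order 0 yields the unit tensor \<open>Dome(1; M)\<close>. The choice is combinatorial: the cube of
  side \<open>n\<close> is cut into \<open>2 \<times> 2 \<times> 2\<close> blocks, each block into its even and its odd half, and each of
  these \<open>2 (n / 2)\<^sup>3 = M\<close> cells with suitable signs carries one summand of the unit tensor
  (\<open>border_le_dome_sum_if_cancelling\<close>, \<open>border_le_dome_sum_cells\<close>).

  The \<open>t\<close>-th Kronecker power of this direct sum has border rank at most \<open>R\<^sup>t\<close> and contains
  \<open>C = t choose k\<close> disjoint copies of \<open>X = Dome(q\<^sup>k; M\<^bsup>t - k\<^esup>)\<close> (\<open>border_le_copies_dome\<close>). To pass from
  \<open>C\<close> copies to one, the border rank of \<open>C\<close> copies of \<open>X\<^bsup>s\<^esup>\<close> is bounded by induction on \<open>s\<close>: multiplying by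
  \<open>X\<close> turns \<open>C\<close> copies into \<open>R\<^sup>t\<close> copies, which are regrouped into bundles of \<open>C\<close>
  (\<open>border_le_kron_copies\<close>, \<open>border_le_copies_kron_power\<close>). Each factor \<open>X\<close> thus costs \<open>R\<^sup>t / C\<close>.

  Finally \<open>k\<close> is taken to be the mode of the binomial distribution with parameters \<open>t\<close> and \<open>p\<close>, so that
  \<open>C\<close> is at least 2 to the power \<open>t h(p) - O(log t)\<close> (\<open>binomial_entropy_lower_bound\<close>). Letting first the
  number \<open>s\<close> of factors and then \<open>t\<close> grow gives the exponent \<open>log R - h(p)\<close>. Monotonicity of the dome in its
  weights absorbs all rounding.
\<close>

section \<open>Border rank as a closure\<close>

definition rank_le :: "nat \<Rightarrow> ('a, 'b, 'c, 'd) tensor4 set" where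
  "rank_le r = {T. \<exists>u v w x. T = (\<lambda>a b c d. \<Sum>s<r. pure_tensor (u s) (v s) (w s) (x s) a b c d)}"

text \<open>
  The closure is taken in the product topology on arrays, so it is defined for all index types.
  Being a closure, \<open>border_le r\<close> is closed under limits without any diagonal argument; this matters
  because approximations with diverging coefficients are composed with each other below.
\<close>

definition border_le :: "nat \<Rightarrow> ('a, 'b, 'c, 'd) tensor4 set" where
  "border_le r = closure (rank_le r)"

lemma rank_leI:
  assumes "finite P" "card P \<le> r"
    and "\<And>a b c d. T a b c d = (\<Sum>s\<in>P. u s a * v s b * w s c * x s d)"
  shows "T \<in> rank_le r"
proof -
  obtain e where e: "bij_betw e {..<card P} P"
    using assms(1) ex_bij_betw_nat_finite atLeast0LessThan by metis
  define U where "U s = (if s < card P then u (e s) else (\<lambda>_. 0))" for s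
  have "T a b c d = (\<Sum>s<r. pure_tensor (U s) (v (e s)) (w (e s)) (x (e s)) a b c d)" for a b c d
  proof -
    have "T a b c d = (\<Sum>s<card P. u (e s) a * v (e s) b * w (e s) c * x (e s) d)"
      unfolding assms(3) by (rule sum.reindex_bij_betw[OF e, symmetric])
    also have "\<dots> = (\<Sum>s<r. pure_tensor (U s) (v (e s)) (w (e s)) (x (e s)) a b c d)"
      by (rule sum.mono_neutral_cong_left) (use assms(2) in \<open>auto simp: U_def pure_tensor_def\<close>)
    finally show ?thesis .
  qed
  then show ?thesis
    unfolding rank_le_def mem_Collect_eq by (intro exI ext)
qed

lemma closed_border_le: "closed (border_le r)"
  by (simp add: border_le_def)

lemma rank_le_imp_border_le: "T \<in> rank_le r \<Longrightarrow> T \<in> border_le r"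
  unfolding border_le_def by (rule subsetD[OF closure_subset])

text \<open>
  The way in which a statement about exact decompositions is carried over to border rank.
\<close>

lemma border_le_image:
  assumes "continuous_on UNIV \<Phi>" "\<And>S. S \<in> rank_le r \<Longrightarrow> \<Phi> S \<in> border_le r'"
    and "T \<in> border_le r"
  shows "\<Phi> T \<in> border_le r'"
proof -
  have "\<Phi> ` closure (rank_le r) \<subseteq> border_le r'"
    by (rule image_closure_subset)
      (use assms closed_border_le in \<open>auto intro: continuous_on_subset\<close>)
  then show ?thesis using assms(3) by (auto simp: border_le_def)
qed

lemma continuous_on_entry:
  "continuous_on UNIV (\<lambda>T :: ('a, 'b, 'c, 'd) tensor4. T a b c d)"
proof -
  have "continuous_on UNIV (\<lambda>T :: ('a, 'b, 'c, 'd) tensor4. T a)"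
    by (rule continuous_on_product_coordinates)
  from this[THEN continuous_on_product_then_coordinatewise, of b,
      THEN continuous_on_product_then_coordinatewise, of c,
      THEN continuous_on_product_then_coordinatewise, of d]
  show ?thesis .
qed

lemma sum_product4:
  fixes A B C D :: "'p \<Rightarrow> complex"
  shows "(\<Sum>p\<in>K. A p) * (\<Sum>p\<in>K. B p) * (\<Sum>p\<in>K. C p) * (\<Sum>p\<in>K. D p)
    = (\<Sum>p1\<in>K. \<Sum>p2\<in>K. \<Sum>p3\<in>K. \<Sum>p4\<in>K. A p1 * B p2 * C p3 * D p4)"
  by (simp only: flip: sum_distrib_left sum_distrib_right)

text \<open>
  Linear maps on the four legs turn pure tensors into pure tensors, so a sum of \<open>card Q\<close> such
  images of \<open>T\<close> multiplies the number of summands by at most \<open>card Q\<close>. Here the matrix entries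
  \<open>\<alpha> q p a\<close> apply to the coordinates \<open>f p a\<close>: this form allows infinite index types, as only the
  finitely many \<open>p\<close> are summed over.
\<close>

lemma border_le_linear:
  fixes \<alpha> :: "'q \<Rightarrow> 'p \<Rightarrow> 'a \<Rightarrow> complex" and \<beta> :: "'q \<Rightarrow> 'p \<Rightarrow> 'b \<Rightarrow> complex"
    and \<gamma> :: "'q \<Rightarrow> 'p \<Rightarrow> 'c \<Rightarrow> complex" and \<delta> :: "'q \<Rightarrow> 'p \<Rightarrow> 'd \<Rightarrow> complex"
  assumes "finite Q" "T \<in> border_le r"
  shows "(\<lambda>a b c d. \<Sum>q\<in>Q. \<Sum>p1\<in>K. \<Sum>p2\<in>K. \<Sum>p3\<in>K. \<Sum>p4\<in>K.
      \<alpha> q p1 a * \<beta> q p2 b * \<gamma> q p3 c * \<delta> q p4 d * T (f p1 a) (g p2 b) (h p3 c) (k p4 d))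
    \<in> border_le (card Q * r)"
  (is "?\<Phi> T \<in> _")
proof (rule border_le_image[OF _ _ assms(2)])
  show "continuous_on UNIV ?\<Phi>"
    by (intro continuous_on_coordinatewise_then_product continuous_on_sum continuous_on_mult
        continuous_on_const continuous_on_entry)
next
  fix S :: "('e, 'f, 'g, 'h) tensor4" assume "S \<in> rank_le r"
  then obtain u v w x where S: "\<And>a b c d. S a b c d = (\<Sum>s<r. u s a * v s b * w s c * x s d)"
    by (auto simp: rank_le_def pure_tensor_def)
  have "?\<Phi> S \<in> rank_le (card Q * r)"
  proof (rule rank_leI)
    show "finite (Q \<times> {..<r})" "card (Q \<times> {..<r}) \<le> card Q * r"
      using assms(1) by (auto simp: card_cartesian_product)
    fix a b c d
    have "?\<Phi> S a b c d = (\<Sum>q\<in>Q. \<Sum>s<r. \<Sum>p1\<in>K. \<Sum>p2\<in>K. \<Sum>p3\<in>K. \<Sum>p4\<in>K.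
       (\<alpha> q p1 a * u s (f p1 a)) * (\<beta> q p2 b * v s (g p2 b))
        * (\<gamma> q p3 c * w s (h p3 c)) * (\<delta> q p4 d * x s (k p4 d)))"
      unfolding S sum_distrib_left
      apply (subst sum.swap[where A="{..<r}" and B=K])+
      by (simp add: mult_ac)
    also have "\<dots> = (\<Sum>(q,s)\<in>Q \<times> {..<r}. (\<Sum>p\<in>K. \<alpha> q p a * u s (f p a)) *
        (\<Sum>p\<in>K. \<beta> q p b * v s (g p b)) * (\<Sum>p\<in>K. \<gamma> q p c * w s (h p c)) * (\<Sum>p\<in>K. \<delta> q p d * x s (k p d)))"
      unfolding sum_product4 by (rule sum.cartesian_product)
    finally show "?\<Phi> S a b c d = (\<Sum>s\<in>Q \<times> {..<r}. (\<lambda>(q,s) a. \<Sum>p\<in>K. \<alpha> q p a * u s (f p a)) s a *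
        (\<lambda>(q,s) b. \<Sum>p\<in>K. \<beta> q p b * v s (g p b)) s b * (\<lambda>(q,s) c. \<Sum>p\<in>K. \<gamma> q p c * w s (h p c)) s c
        * (\<lambda>(q,s) d. \<Sum>p\<in>K. \<delta> q p d * x s (k p d)) s d)"
      by (simp add: case_prod_unfold)
  qed
  then show "?\<Phi> S \<in> border_le (card Q * r)" by (rule rank_le_imp_border_le)
qed

text \<open>
  The case of a single term: renaming and identifying coordinates, and setting some of them to
  zero.
\<close>

lemma border_le_pullback:
  assumes "T \<in> border_le r"
    and "\<And>a b c d. S a b c d = \<alpha> a * \<beta> b * \<gamma> c * \<delta> d * T (f a) (g b) (h c) (k d)"
  shows "S \<in> border_le r"
proof -
  have S: "S = (\<lambda>a b c d. \<alpha> a * \<beta> b * \<gamma> c * \<delta> d * T (f a) (g b) (h c) (k d))"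
    by (intro ext) (rule assms(2))
  show ?thesis
    unfolding S
    using border_le_linear[OF _ assms(1), where Q="{()}" and K="{()}" and \<alpha>="\<lambda>_ _. \<alpha>"
    and \<beta>="\<lambda>_ _. \<beta>" and \<gamma>="\<lambda>_ _. \<gamma>" and \<delta>="\<lambda>_ _. \<delta>" and f="\<lambda>_. f" and g="\<lambda>_. g"
    and h="\<lambda>_. h" and k="\<lambda>_. k"]
    by simp
qed

section \<open>Kronecker products and direct sums of copies\<close>

definition kron :: "('a, 'b, 'c, 'd) tensor4 \<Rightarrow> ('e, 'f, 'g, 'h) tensor4
    \<Rightarrow> ('a \<times> 'e, 'b \<times> 'f, 'c \<times> 'g, 'd \<times> 'h) tensor4" where
  "kron T S = (\<lambda>(a, a') (b, b') (c, c') (d, d'). T a b c d * S a' b' c' d')"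

definition copies :: "nat \<Rightarrow> ('a, 'b, 'c, 'd) tensor4
    \<Rightarrow> (nat \<times> 'a, nat \<times> 'b, nat \<times> 'c, nat \<times> 'd) tensor4" where
  "copies C T = (\<lambda>(p, a) (q, b) (s, c) (t, d).
     of_bool (p < C \<and> p = q \<and> q = s \<and> s = t) * T a b c d)"

lemma sum_diagonal4:
  fixes F :: "nat \<Rightarrow> nat \<Rightarrow> nat \<Rightarrow> nat \<Rightarrow> complex"
  shows "(\<Sum>p<C. \<Sum>q<C. \<Sum>s<C. \<Sum>t<C. F p q s t * of_bool (p < C \<and> p = q \<and> q = s \<and> s = t))
    = (\<Sum>p<C. F p p p p)"
proof -
  have 1: "F p q s t * of_bool (p < C \<and> p = q \<and> q = s \<and> s = t) =
     of_bool (q = p) * (of_bool (s = p) * (of_bool (t = p) * F p q s t))" if "p < C" for p q s t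
    using that by auto
  have 2: "(\<Sum>q<C. of_bool (q = p) * f q) = f p" if "p < C" for p and f :: "nat \<Rightarrow> complex"
    using that by (simp add: of_bool_def if_distrib[where f="\<lambda>x. x * _"] cong: if_cong)
  have "(\<Sum>q<C. \<Sum>s<C. \<Sum>t<C. F p q s t * of_bool (p < C \<and> p = q \<and> q = s \<and> s = t)) = F p p p p"
    if "p < C" for p
    by (simp only: 1[OF that] 2[OF that] flip: sum_distrib_left)
  then show ?thesis by (intro sum.cong) auto
qed

text \<open>
  The step behind Schoenhage's asymptotic sum inequality. If \<open>D\<close> is a sum of \<open>r\<close> pure tensors, then
  \<open>kron D Y\<close> is an image of \<open>r\<close> disjoint copies of \<open>Y\<close>, and these are \<open>r / C\<close>, rounded up, groups of \<open>C\<close>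
  copies. A group costs only \<open>\<rho>\<close>, which may be much less than \<open>C\<close> times the cost of one \<open>Y\<close>.
\<close>

lemma border_le_kron_copies:
  fixes Y :: "('e, 'f, 'g, 'h) tensor4" and D :: "('a, 'b, 'c, 'd) tensor4"
  assumes D: "D \<in> border_le r" and Y: "copies C Y \<in> border_le \<rho>" and r: "r \<le> Q * C"
  shows "kron D Y \<in> border_le (Q * \<rho>)"
proof (rule border_le_image[OF _ _ D, where \<Phi>="\<lambda>D. kron D Y"])
  show "continuous_on UNIV (\<lambda>D :: ('a, 'b, 'c, 'd) tensor4. kron D Y)"
    unfolding kron_def case_prod_unfold
    by (intro continuous_on_coordinatewise_then_product continuous_on_mult
        continuous_on_const continuous_on_entry)
next
  fix S :: "('a, 'b, 'c, 'd) tensor4" assume "S \<in> rank_le r"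
  then obtain u v w x where S: "\<And>a b c d. S a b c d = (\<Sum>s<r. u s a * v s b * w s c * x s d)"
    by (auto simp: rank_le_def pure_tensor_def)
  \<comment> \<open>Zero vectors fill up the last group.\<close>
  define U where "U s = (if s < r then u s else (\<lambda>_. 0))" for s
  have S': "S a b c d = (\<Sum>q<Q. \<Sum>p<C. U (q * C + p) a * v (q * C + p) b * w (q * C + p) c * x (q * C + p) d)"
    for a b c d
  proof -
    have "S a b c d = (\<Sum>s<Q * C. U s a * v s b * w s c * x s d)"
      unfolding S by (rule sum.mono_neutral_cong_left) (use r in \<open>auto simp: U_def\<close>)
    also have "\<dots> = (\<Sum>q<Q. \<Sum>s=q*C..<q*C+C. U s a * v s b * w s c * x s d)"
      by (rule sum.nat_group[symmetric])
    also have "\<dots> = (\<Sum>q<Q. \<Sum>p<C. U (q * C + p) a * v (q * C + p) b * w (q * C + p) c * x (q * C + p) d)"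
      by (subst sum.atLeastLessThan_shift_0) (simp add: atLeast0LessThan)
    finally show ?thesis .
  qed
  have "(\<lambda>a b c d. \<Sum>q<Q. \<Sum>p1<C. \<Sum>p2<C. \<Sum>p3<C. \<Sum>p4<C.
      U (q * C + p1) (fst a) * v (q * C + p2) (fst b) * w (q * C + p3) (fst c) * x (q * C + p4) (fst d) *
      copies C Y (p1, snd a) (p2, snd b) (p3, snd c) (p4, snd d)) \<in> border_le (card {..<Q} * \<rho>)"
    by (rule border_le_linear[OF _ Y]) simp
  also have "(\<lambda>a b c d. \<Sum>q<Q. \<Sum>p1<C. \<Sum>p2<C. \<Sum>p3<C. \<Sum>p4<C.
      U (q * C + p1) (fst a) * v (q * C + p2) (fst b) * w (q * C + p3) (fst c) * x (q * C + p4) (fst d) *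
      copies C Y (p1, snd a) (p2, snd b) (p3, snd c) (p4, snd d)) = kron S Y"
  proof (intro ext)
    fix a b c d
    have "(\<Sum>p1<C. \<Sum>p2<C. \<Sum>p3<C. \<Sum>p4<C.
      U (q * C + p1) (fst a) * v (q * C + p2) (fst b) * w (q * C + p3) (fst c) * x (q * C + p4) (fst d) *
      copies C Y (p1, snd a) (p2, snd b) (p3, snd c) (p4, snd d)) = 
      (\<Sum>p<C. U (q * C + p) (fst a) * v (q * C + p) (fst b) * w (q * C + p) (fst c) * x (q * C + p) (fst d)
         * Y (snd a) (snd b) (snd c) (snd d))" for q
      by (rule trans[OF _ sum_diagonal4[where F="\<lambda>p1 p2 p3 p4. U (q * C + p1) (fst a)
            * v (q * C + p2) (fst b) * w (q * C + p3) (fst c) * x (q * C + p4) (fst d)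
            * Y (snd a) (snd b) (snd c) (snd d)"]])
        (intro sum.cong refl, simp add: copies_def mult_ac)
    then show "(\<Sum>q<Q. \<Sum>p1<C. \<Sum>p2<C. \<Sum>p3<C. \<Sum>p4<C.
      U (q * C + p1) (fst a) * v (q * C + p2) (fst b) * w (q * C + p3) (fst c) * x (q * C + p4) (fst d) *
      copies C Y (p1, snd a) (p2, snd b) (p3, snd c) (p4, snd d)) = kron S Y a b c d"
      by (simp add: kron_def S' sum_distrib_right case_prod_unfold)
  qed
  finally show "kron S Y \<in> border_le (Q * \<rho>)" by simp
qed

lemma border_le_kron:
  assumes "T \<in> border_le r" "S \<in> border_le \<rho>"
  shows "kron T S \<in> border_le (r * \<rho>)"
proof (rule border_le_kron_copies[OF assms(1), where C=1])
  show "copies 1 S \<in> border_le \<rho>"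
    by (rule border_le_pullback[OF assms(2), where \<alpha>="\<lambda>p. of_bool (fst p = 0)"
          and \<beta>="\<lambda>p. of_bool (fst p = 0)" and \<gamma>="\<lambda>p. of_bool (fst p = 0)"
          and \<delta>="\<lambda>p. of_bool (fst p = 0)" and f=snd and g=snd and h=snd and k=snd])
      (auto simp: copies_def)
qed simp

text \<open>
  Functions on \<open>nat\<close> serve as tuples of length \<open>N\<close>: only the arguments below \<open>N\<close> matter. With tuples
  indexed by positions, a subset of the positions can be singled out directly.
\<close>

definition kron_power :: "nat \<Rightarrow> ('a, 'b, 'c, 'd) tensor4
    \<Rightarrow> (nat \<Rightarrow> 'a, nat \<Rightarrow> 'b, nat \<Rightarrow> 'c, nat \<Rightarrow> 'd) tensor4" where
  "kron_power N T = (\<lambda>a b c d. \<Prod>p<N. T (a p) (b p) (c p) (d p))"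

lemma border_le_kron_power:
  assumes "T \<in> border_le r"
  shows "kron_power N T \<in> border_le (r ^ N)"
proof (induction N)
  case 0
  have "kron_power 0 T \<in> rank_le 1"
    by (rule rank_leI[where P="{()}" and u="\<lambda>_ _. 1" and v="\<lambda>_ _. 1" and w="\<lambda>_ _. 1"
          and x="\<lambda>_ _. 1"]) (auto simp: kron_power_def)
  then show ?case by (simp add: rank_le_imp_border_le)
next
  case (Suc N)
  have "kron_power (Suc N) T \<in> border_le (r * r ^ N)"
    by (rule border_le_pullback[OF border_le_kron[OF assms Suc], where \<alpha>="\<lambda>_. 1"
          and \<beta>="\<lambda>_. 1" and \<gamma>="\<lambda>_. 1" and \<delta>="\<lambda>_. 1" and f="\<lambda>a. (a N, a)"
          and g="\<lambda>a. (a N, a)" and h="\<lambda>a. (a N, a)" and k="\<lambda>a. (a N, a)"])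
      (simp add: kron_def kron_power_def)
  then show ?case by simp
qed

text \<open>
  Iterating the previous grouping step: although only \<open>C\<close> copies of \<open>X\<close> together are known to be
  cheap, each factor \<open>X\<close> of a large power costs no more than its share \<open>Q\<close> of \<open>r\<close>.
\<close>

lemma border_le_copies_kron_power:
  assumes X: "copies C X \<in> border_le r" and r: "r \<le> Q * C"
  shows "copies C (kron_power s X) \<in> border_le (Q ^ s * C)"
proof (induction s)
  case 0
  have "copies C (kron_power 0 X) \<in> rank_le C"
    by (rule rank_leI[where P="{..<C}" and u="\<lambda>p a. of_bool (fst a = p)"
          and v="\<lambda>p a. of_bool (fst a = p)" and w="\<lambda>p a. of_bool (fst a = p)"
          and x="\<lambda>p a. of_bool (fst a = p)"])
       (auto simp: kron_power_def copies_def of_bool_def if_distrib [where f="\<lambda>x. x * _"] cong: if_cong)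
  then show ?case by (simp add: rank_le_imp_border_le)
next
  case (Suc s)
  have "copies C (kron_power (Suc s) X) \<in> border_le (Q * (Q ^ s * C))"
    by (rule border_le_pullback[OF border_le_kron_copies[OF X Suc r], where \<alpha>="\<lambda>_. 1"
          and \<beta>="\<lambda>_. 1" and \<gamma>="\<lambda>_. 1" and \<delta>="\<lambda>_. 1" and f="\<lambda>a. ((fst a, snd a s), snd a)"
          and g="\<lambda>a. ((fst a, snd a s), snd a)" and h="\<lambda>a. ((fst a, snd a s), snd a)"
          and k="\<lambda>a. ((fst a, snd a s), snd a)"])
      (auto simp: kron_def kron_power_def copies_def)
  then show ?case by (simp add: mult_ac)
qed

lemma border_le_kron_power_of_copies:
  assumes X: "copies C X \<in> border_le r" and "r \<le> Q * C" "C > 0"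
  shows "kron_power s X \<in> border_le (Q ^ s * C)"
  by (rule border_le_pullback[OF border_le_copies_kron_power[OF assms(1,2)], where \<alpha>="\<lambda>_. 1"
          and \<beta>="\<lambda>_. 1" and \<gamma>="\<lambda>_. 1" and \<delta>="\<lambda>_. 1" and f="\<lambda>a. (0, a)"
          and g="\<lambda>a. (0, a)" and h="\<lambda>a. (0, a)" and k="\<lambda>a. (0, a)"])
     (use assms(3) in \<open>auto simp: copies_def\<close>)


section \<open>A degeneration producing two domes at once\<close>

text \<open>
  The direct sum of a dome with trivial hyperedge, whose edges carry the labels in \<open>I\<close>, and a dome
  with trivial edges, whose hyperedge carries the labels in \<open>\<Lambda>\<close>.
\<close>

definition dome_sum :: "'i set \<Rightarrow> 'l set
    \<Rightarrow> ('i + 'l, 'i + 'l, 'i + 'l, ('i \<times> 'i \<times> 'i) + unit) tensor4" where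
  "dome_sum I \<Lambda> a b c d = (case d of
      Inl (i, j, k) \<Rightarrow> of_bool (i \<in> I \<and> j \<in> I \<and> k \<in> I \<and> a = Inl i \<and> b = Inl j \<and> c = Inl k)
    | Inr _ \<Rightarrow> of_bool (\<exists>l\<in>\<Lambda>. a = Inr l \<and> b = Inr l \<and> c = Inr l))"

text \<open>
  The vector \<open>x\<^sub>i + \<epsilon> \<Sum>\<^sub>l f l a\<^sub>l\<close>, where \<open>x\<^sub>i\<close> and \<open>a\<^sub>l\<close> are the basis vectors for \<open>Inl i\<close> and \<open>Inr l\<close>.
\<close>

definition perturb :: "complex \<Rightarrow> 'i \<Rightarrow> ('l \<Rightarrow> complex) \<Rightarrow> 'i + 'l \<Rightarrow> complex" where
  "perturb \<epsilon> i f a = (case a of Inl i' \<Rightarrow> if i = i' then 1 else 0 | Inr l \<Rightarrow> \<epsilon> * f l)"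

lemma perturb_simps [simp]:
  "perturb \<epsilon> i f (Inl i') = (if i = i' then 1 else 0)"
  "perturb \<epsilon> i f (Inr l) = \<epsilon> * f l"
  by (simp_all add: perturb_def)

lemma sum_if_const: "(\<Sum>x\<in>A. if P then f x else 0) = (if P then \<Sum>x\<in>A. f x else (0::complex))"
  by simp

text \<open>
  An identity in the style of Schoenhage. With vectors \<open>u\<close>, \<open>v\<close>, \<open>w\<close> in the hyperedge coordinates,
  consider
    \<open>\<Sum>\<^sub>i\<^sub>j\<^sub>k (x\<^sub>i + \<epsilon> u\<^sub>i\<^sub>j\<^sub>k) (y\<^sub>j + \<epsilon> v\<^sub>i\<^sub>j\<^sub>k) (z\<^sub>k + \<epsilon> w\<^sub>i\<^sub>j\<^sub>k) (e\<^sub>i\<^sub>j\<^sub>k + \<epsilon>\<^bsup>-3\<^esup> f) - \<epsilon>\<^bsup>-3\<^esup> (\<Sum> x\<^sub>i) (\<Sum> y\<^sub>j) (\<Sum> z\<^sub>k) f\<close>.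
  The coefficient of \<open>f\<close> has terms of degree \<open>-3\<close>, \<open>-2\<close>, \<open>-1\<close> and \<open>0\<close> in \<open>\<epsilon>\<close>. The first is cancelled by the
  correction term, the next two by the hypotheses on single sums and on double sums, and the
  last is the unit tensor by the hypothesis on the triple sum. As \<open>\<epsilon>\<close> tends to 0, the remaining part
  becomes the dome with edge labels \<open>I\<close>.
\<close>

lemma border_le_dome_sum_if_cancelling:
  fixes U V W :: "'i \<Rightarrow> 'i \<Rightarrow> 'i \<Rightarrow> 'l \<Rightarrow> complex"
  assumes fin: "finite I"
    and u: "\<And>j k l. j \<in> I \<Longrightarrow> k \<in> I \<Longrightarrow> (\<Sum>i\<in>I. U i j k l) = 0"
    and v: "\<And>i k l. i \<in> I \<Longrightarrow> k \<in> I \<Longrightarrow> (\<Sum>j\<in>I. V i j k l) = 0"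
    and w: "\<And>i j l. i \<in> I \<Longrightarrow> j \<in> I \<Longrightarrow> (\<Sum>k\<in>I. W i j k l) = 0"
    and uv: "\<And>k l m. k \<in> I \<Longrightarrow> (\<Sum>i\<in>I. \<Sum>j\<in>I. U i j k l * V i j k m) = 0"
    and uw: "\<And>j l m. j \<in> I \<Longrightarrow> (\<Sum>i\<in>I. \<Sum>k\<in>I. U i j k l * W i j k m) = 0"
    and vw: "\<And>i l m. i \<in> I \<Longrightarrow> (\<Sum>j\<in>I. \<Sum>k\<in>I. V i j k l * W i j k m) = 0"
    and uvw: "\<And>l m n. (\<Sum>i\<in>I. \<Sum>j\<in>I. \<Sum>k\<in>I. U i j k l * V i j k m * W i j k n)
      = of_bool (l \<in> \<Lambda> \<and> l = m \<and> m = n)"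
  shows "dome_sum I \<Lambda> \<in> border_le (card I ^ 3 + 1)"
proof -
  define x y z where "x \<epsilon> i j k = perturb \<epsilon> i (U i j k)"
    and "y \<epsilon> i j k = perturb \<epsilon> j (V i j k)" and "z \<epsilon> i j k = perturb \<epsilon> k (W i j k)"
    for \<epsilon> i j k
  define x0 :: "'i + 'l \<Rightarrow> complex" where
    "x0 a = (case a of Inl i \<Rightarrow> of_bool (i \<in> I) | Inr _ \<Rightarrow> 0)" for a
  have factor: "(\<Sum>j\<in>I. c * f j) = c * (\<Sum>j\<in>I. f j)" for c :: complex and f
    by (rule sum_distrib_left[symmetric])
  have key: "(\<Sum>i\<in>I. \<Sum>j\<in>I. \<Sum>k\<in>I. x \<epsilon> i j k a * y \<epsilon> i j k b * z \<epsilon> i j k c)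
      = x0 a * x0 b * x0 c + \<epsilon> ^ 3 * dome_sum I \<Lambda> a b c (Inr ())" (is "?L = _") for \<epsilon> a b c
  proof -
    note defs = x_def y_def z_def x0_def dome_sum_def
    note if_rules = if_distrib[where f="\<lambda>t. t * _"] if_distrib[where f="\<lambda>t. _ * t"] sum_if_const
    show ?thesis
    proof (cases a; cases b; cases c)
      fix i j k assume "a = Inl i" "b = Inl j" "c = Inl k"
      then show ?thesis using fin by (simp add: defs if_rules cong: if_cong)
    next
      fix i j k assume "a = Inl i" "b = Inl j" "c = Inr k"
      then show ?thesis using fin by (simp add: defs if_rules factor w cong: if_cong)
    next
      fix i j k assume "a = Inl i" "b = Inr j" "c = Inl k"
      then show ?thesis using fin by (simp add: defs if_rules factor v cong: if_cong)
    next
      fix i j k assume "a = Inr i" "b = Inl j" "c = Inl k"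
      then show ?thesis using fin by (simp add: defs if_rules factor u cong: if_cong)
    next
      fix l m k assume *: "a = Inr l" "b = Inr m" "c = Inl k"
      have "?L = (if k \<in> I then \<epsilon>^2 * (\<Sum>i\<in>I. \<Sum>j\<in>I. U i j k l * V i j k m) else 0)"
        using fin unfolding sum_distrib_left 
        by (simp add: * defs if_rules power2_eq_square mult_ac cong: if_cong)
      then show ?thesis using * uv[of k l m] by (auto simp: defs)
    next
      fix l m k assume *: "a = Inr l" "b = Inl k" "c = Inr m"
      have "?L = (if k \<in> I then \<epsilon>^2 * (\<Sum>i\<in>I. \<Sum>j\<in>I. U i k j l * W i k j m) else 0)"
        using fin unfolding sum_distrib_left
        by (simp add: * defs if_rules power2_eq_square mult_ac cong: if_cong)
      then show ?thesis using * uw[of k l m] by (auto simp: defs)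
    next
      fix l m k assume *: "a = Inl k" "b = Inr l" "c = Inr m"
      have "?L = (if k \<in> I then \<epsilon>^2 * (\<Sum>i\<in>I. \<Sum>j\<in>I. V k i j l * W k i j m) else 0)"
        using fin unfolding sum_distrib_left
        by (simp add: * defs if_rules power2_eq_square mult_ac cong: if_cong)
      then show ?thesis using * vw[of k l m] by (auto simp: defs)
    next
      fix l m n assume *: "a = Inr l" "b = Inr m" "c = Inr n"
      have "?L = \<epsilon>^3 * (\<Sum>i\<in>I. \<Sum>j\<in>I. \<Sum>k\<in>I. U i j k l * V i j k m * W i j k n)"
        unfolding sum_distrib_left by (simp add: * defs power3_eq_cube mult_ac)
      then show ?thesis using * by (auto simp: defs uvw)
    qed
  qed
  \<comment> \<open>The value of the identity, written without negative powers of \<open>\<epsilon>\<close> so that it extends to 0.\<close>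
  define \<Phi> :: "complex \<Rightarrow> ('i + 'l, 'i + 'l, 'i + 'l, ('i \<times> 'i \<times> 'i) + unit) tensor4" where
    "\<Phi> \<epsilon> a b c d = (case d of
        Inl (i, j, k) \<Rightarrow> of_bool (i \<in> I \<and> j \<in> I \<and> k \<in> I) * x \<epsilon> i j k a * y \<epsilon> i j k b * z \<epsilon> i j k c
      | Inr _ \<Rightarrow> dome_sum I \<Lambda> a b c d)" for \<epsilon> a b c d
  have "\<Phi> ` closure (- {0}) \<subseteq> border_le (card I ^ 3 + 1)"
  proof (rule image_closure_subset)
    have "continuous_on UNIV (\<lambda>\<epsilon>. \<Phi> \<epsilon> a b c d)" for a b c d
      unfolding \<Phi>_def x_def y_def z_def perturb_def
      by (cases d; cases a; cases b; cases c) (auto intro!: continuous_intros)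
    then have "continuous_on UNIV \<Phi>"
      by (intro continuous_on_coordinatewise_then_product)
    then show "continuous_on (closure (- {0})) \<Phi>"
      by (rule continuous_on_subset) simp
  next
    have "\<Phi> \<epsilon> \<in> rank_le (card I ^ 3 + 1)" if "\<epsilon> \<noteq> 0" for \<epsilon>
    proof (rule rank_leI)
      let ?P = "insert None (Some ` (I \<times> I \<times> I))"
      show "finite ?P" using fin by simp
      show "card ?P \<le> card I ^ 3 + 1"
        using fin by (simp add: card_image card_cartesian_product power3_eq_cube)
      \<comment> \<open>The index \<open>None\<close> stands for the correction term.\<close>
      define f where "f g s = (case s of None \<Rightarrow> x0 | Some (i, j, k) \<Rightarrow> g \<epsilon> i j k)"
        for g :: "complex \<Rightarrow> 'i \<Rightarrow> 'i \<Rightarrow> 'i \<Rightarrow> 'i + 'l \<Rightarrow> complex" and s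
      define e where "e s d = (case s of 
          None \<Rightarrow> (case d of Inl _ \<Rightarrow> 0 | Inr _ \<Rightarrow> - 1 / \<epsilon> ^ 3)
        | Some t \<Rightarrow> (case d of Inl t' \<Rightarrow> if t = t' then 1 else 0 | Inr _ \<Rightarrow> 1 / \<epsilon> ^ 3))"
        for s and d :: "('i \<times> 'i \<times> 'i) + unit"
      fix a b c d
      have "(\<Sum>s\<in>?P. f x s a * f y s b * f z s c * e s d) = x0 a * x0 b * x0 c * e None d
         + (\<Sum>t\<in>I \<times> I \<times> I. f x (Some t) a * f y (Some t) b * f z (Some t) c * e (Some t) d)"
        using fin by (subst sum.insert) (auto simp: sum.reindex f_def)
      also have "\<dots> = \<Phi> \<epsilon> a b c d"
      proof (cases d)
        case (Inl t)
        then show ?thesis using fin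
          by (cases t) (auto simp: e_def \<Phi>_def f_def if_distrib[where f="\<lambda>t. _ * t"] cong: if_cong)
      next
        case (Inr t)
        have "(\<Sum>t\<in>I \<times> I \<times> I. f x (Some t) a * f y (Some t) b * f z (Some t) c * e (Some t) d)
          = (\<Sum>i\<in>I. \<Sum>j\<in>I. \<Sum>k\<in>I. x \<epsilon> i j k a * y \<epsilon> i j k b * z \<epsilon> i j k c) * (1 / \<epsilon> ^ 3)"
          using Inr by (simp add: sum.cartesian_product sum_divide_distrib f_def e_def case_prod_unfold)
        then show ?thesis
          using Inr that unfolding key by (simp add: \<Phi>_def e_def field_simps)
      qed
      finally show "\<Phi> \<epsilon> a b c d = (\<Sum>s\<in>?P. f x s a * f y s b * f z s c * e s d)" ..
    qed
    then show "\<Phi> ` (- {0}) \<subseteq> border_le (card I ^ 3 + 1)"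
      using rank_le_imp_border_le by auto
  qed (rule closed_border_le)
  moreover have "0 \<in> closure (- {0 :: complex})"
    by (simp add: closure_complement)
  moreover have "\<Phi> 0 = dome_sum I \<Lambda>"
    by (intro ext) (auto simp: \<Phi>_def dome_sum_def x_def y_def z_def perturb_def split: sum.splits)
  ultimately show ?thesis by (metis image_subset_iff)
qed

text \<open>
  One additional label on each edge makes the single sums vanish: the entry at \<open>None\<close> in the
  direction to be summed is minus the sum of the others. These new entries do not disturb the
  double and triple sums, because \<open>U\<close>, \<open>V\<close> and \<open>W\<close> have theirs on different faces of the cube, and
  each of the three vanishes on the faces of the other two.
\<close>

lemma border_le_dome_sum_extend:
  fixes u v w :: "'i \<Rightarrow> 'i \<Rightarrow> 'i \<Rightarrow> 'l \<Rightarrow> complex"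
  assumes fin: "finite I"
    and uv: "\<And>k l m. k \<in> I \<Longrightarrow> (\<Sum>i\<in>I. \<Sum>j\<in>I. u i j k l * v i j k m) = 0"
    and uw: "\<And>j l m. j \<in> I \<Longrightarrow> (\<Sum>i\<in>I. \<Sum>k\<in>I. u i j k l * w i j k m) = 0"
    and vw: "\<And>i l m. i \<in> I \<Longrightarrow> (\<Sum>j\<in>I. \<Sum>k\<in>I. v i j k l * w i j k m) = 0"
    and uvw: "\<And>l m n. (\<Sum>i\<in>I. \<Sum>j\<in>I. \<Sum>k\<in>I. u i j k l * v i j k m * w i j k n)
      = of_bool (l \<in> \<Lambda> \<and> l = m \<and> m = n)"
  shows "dome_sum (insert None (Some ` I)) \<Lambda> \<in> border_le ((card I + 1) ^ 3 + 1)"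
proof -
  define U where "U i j k l = (case (j, k) of
      (Some j', Some k') \<Rightarrow> (case i of Some i' \<Rightarrow> u i' j' k' l | None \<Rightarrow> - (\<Sum>i'\<in>I. u i' j' k' l))
    | _ \<Rightarrow> 0)" for i j k l
  define V where "V i j k l = (case (i, k) of
      (Some i', Some k') \<Rightarrow> (case j of Some j' \<Rightarrow> v i' j' k' l | None \<Rightarrow> - (\<Sum>j'\<in>I. v i' j' k' l))
    | _ \<Rightarrow> 0)" for i j k l
  define W where "W i j k l = (case (i, j) of
      (Some i', Some j') \<Rightarrow> (case k of Some k' \<Rightarrow> w i' j' k' l | None \<Rightarrow> - (\<Sum>k'\<in>I. w i' j' k' l))
    | _ \<Rightarrow> 0)" for i j k l
  have sum_option: "(\<Sum>i\<in>insert None (Some ` I). f i) = f None + (\<Sum>i\<in>I. f (Some i))"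
    for f :: "'i option \<Rightarrow> complex"
    using fin by (subst sum.insert) (auto simp: sum.reindex)
  have "dome_sum (insert None (Some ` I)) \<Lambda> \<in> border_le (card (insert None (Some ` I)) ^ 3 + 1)"
  proof (rule border_le_dome_sum_if_cancelling[where U=U and V=V and W=W])
    fix l m n
    show "(\<Sum>i\<in>insert None (Some ` I). \<Sum>j\<in>insert None (Some ` I). \<Sum>k\<in>insert None (Some ` I).
        U i j k l * V i j k m * W i j k n) = of_bool (l \<in> \<Lambda> \<and> l = m \<and> m = n)"
      unfolding sum_option using uvw[of l m n] by (simp add: U_def V_def W_def)
  qed (use fin uv uw vw in \<open>auto simp: sum_option U_def V_def W_def split: option.splits\<close>)
  also have "card (insert None (Some ` I)) = card I + 1"
    using fin by (simp add: card_image)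
  finally show ?thesis .
qed

lemma sum_times_bool:
  fixes f :: "'h \<times> bool \<Rightarrow> complex"
  shows "(\<Sum>p\<in>H \<times> UNIV. f p) = (\<Sum>x\<in>H. \<Sum>\<alpha>\<in>UNIV. f (x, \<alpha>))"
  by (simp add: sum.cartesian_product)

lemma sum_times_bool2:
  fixes f :: "'h \<times> bool \<Rightarrow> 'h \<times> bool \<Rightarrow> complex"
  shows "(\<Sum>p\<in>H \<times> UNIV. \<Sum>q\<in>H \<times> UNIV. f p q) = (\<Sum>x\<in>H. \<Sum>y\<in>H.
     f (x, True) (y, True) + f (x, True) (y, False) + f (x, False) (y, True) + f (x, False) (y, False))"
  by (simp add: sum_times_bool) (simp add: UNIV_bool sum.distrib add_ac)

lemma sum_times_bool3:
  fixes f :: "'h \<times> bool \<Rightarrow> 'h \<times> bool \<Rightarrow> 'h \<times> bool \<Rightarrow> complex"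
  shows "(\<Sum>p\<in>H \<times> UNIV. \<Sum>q\<in>H \<times> UNIV. \<Sum>r\<in>H \<times> UNIV. f p q r) = (\<Sum>x\<in>H. \<Sum>y\<in>H. \<Sum>z\<in>H.
     \<Sum>\<alpha>\<in>UNIV. \<Sum>\<beta>\<in>UNIV. \<Sum>\<gamma>\<in>UNIV. f (x, \<alpha>) (y, \<beta>) (z, \<gamma>))"
  by (simp add: sum_times_bool) (simp add: UNIV_bool sum.distrib add_ac)

definition bool_sign :: "bool \<Rightarrow> complex" where
  "bool_sign \<beta> = (if \<beta> then - 1 else 1)"

text \<open>
  A pair \<open>(x, \<alpha>)\<close> stands for the number \<open>2 x + \<alpha>\<close>. The cube of side \<open>2 h\<close> is thus cut into
  \<open>2 \<times> 2 \<times> 2\<close> blocks, and each block into its four points of even and its four points of odd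
  parity. Such a half block is a cell: it meets every slice of its block in exactly two points,
  and these differ in both remaining coordinates. Hence a sign that depends on exactly one of
  these two coordinates sums to zero over the slice.
\<close>

fun cell :: "'h \<times> bool \<Rightarrow> 'h \<times> bool \<Rightarrow> 'h \<times> bool \<Rightarrow> 'h \<times> 'h \<times> 'h \<times> bool" where
  "cell (x, \<alpha>) (y, \<beta>) (z, \<gamma>) = (x, y, z, \<alpha> \<noteq> (\<beta> \<noteq> \<gamma>))"

text \<open>
  Every cell supports one hyperedge label, which gives \<open>2 h\<^sup>3\<close> labels. The signs of \<open>u\<close>, \<open>v\<close>, \<open>w\<close>
  are those of \<open>j\<close>, \<open>k\<close> and both together. The product of two of them is the third, and it
  changes between the two points of a cell in each slice over which the corresponding double sum
  runs. The product of all three is 1, and the factor \<open>1 / 4\<close> is the reciprocal of the size of a cell.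
\<close>

lemma border_le_dome_sum_cells:
  fixes H :: "'h set"
  assumes "finite H"
  shows "dome_sum (insert None (Some ` (H \<times> (UNIV :: bool set)))) (H \<times> H \<times> H \<times> (UNIV :: bool set))
    \<in> border_le ((2 * card H + 1) ^ 3 + 1)"
proof -
  let ?I = "H \<times> (UNIV :: bool set)"
  define u v w where "u i j k l = bool_sign (snd j) * of_bool (l = cell i j k)"
    and "v i j k l = bool_sign (snd k) * of_bool (l = cell i j k)"
    and "w i j k l = bool_sign (snd j) * bool_sign (snd k) / 4 * of_bool (l = cell i j k)"
    for i j k :: "'h \<times> bool" and l
  note defs = u_def v_def w_def bool_sign_def
  have "dome_sum (insert None (Some ` ?I)) (H \<times> H \<times> H \<times> (UNIV :: bool set)) \<in> border_le ((card ?I + 1) ^ 3 + 1)"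
  proof (rule border_le_dome_sum_extend[where u=u and v=v and w=w])
    show "finite ?I" using assms by simp
  next
    fix k l m
    show "(\<Sum>i\<in>?I. \<Sum>j\<in>?I. u i j k l * v i j k m) = 0"
      unfolding sum_times_bool2
      by (cases k; cases l; cases m) (auto intro!: sum.neutral simp: defs)
  next
    fix j l m
    show "(\<Sum>i\<in>?I. \<Sum>k\<in>?I. u i j k l * w i j k m) = 0"
      unfolding sum_times_bool2
      by (cases j; cases l; cases m) (auto intro!: sum.neutral simp: defs)
  next
    fix i l m
    show "(\<Sum>j\<in>?I. \<Sum>k\<in>?I. v i j k l * w i j k m) = 0"
      unfolding sum_times_bool2
      by (cases i; cases l; cases m) (auto intro!: sum.neutral simp: defs)
  next
    fix l m n :: "'h \<times> 'h \<times> 'h \<times> bool"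
    obtain x0 y0 z0 \<pi> where l: "l = (x0, y0, z0, \<pi>)" by (cases l)
    have "(\<Sum>\<alpha>\<in>UNIV. \<Sum>\<beta>\<in>UNIV. \<Sum>\<gamma>\<in>UNIV. u (x, \<alpha>) (y, \<beta>) (z, \<gamma>) l * v (x, \<alpha>) (y, \<beta>) (z, \<gamma>) m
       * w (x, \<alpha>) (y, \<beta>) (z, \<gamma>) n)
       = (if x = x0 then if y = y0 then if z = z0 then of_bool (l = m \<and> m = n) else 0 else 0 else 0)"
      for x y z
      by (cases m; cases n; cases \<pi>) (auto simp: UNIV_bool defs l)
    then show "(\<Sum>i\<in>?I. \<Sum>j\<in>?I. \<Sum>k\<in>?I. u i j k l * v i j k m * w i j k n)
        = of_bool (l \<in> H \<times> H \<times> H \<times> UNIV \<and> l = m \<and> m = n)"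
      unfolding sum_times_bool3 using assms by (simp add: sum_if_const l cong: if_cong)
  qed
  then show ?thesis by (simp add: card_cartesian_product mult.commute)
qed


section \<open>Domes inside powers\<close>

lemma dome_entry:
  "dome m L (i1, l1) (i2, l2) (i3, l3) (j1, j2, j3) =
    of_bool (i1 = j1 \<and> i2 = j2 \<and> i3 = j3 \<and> l1 = l2 \<and> l2 = l3 \<and>
      j1 \<in> {1..m} \<and> j2 \<in> {1..m} \<and> j3 \<in> {1..m} \<and> l1 \<in> {1..L})"
proof -
  have "pure_tensor (basis_vec (s1, t)) (basis_vec (s2, t)) (basis_vec (s3, t))
      (basis_vec (s1, s2, s3)) (i1, l1) (i2, l2) (i3, l3) (j1, j2, j3) =
    (if s1 = j1 then if s2 = j2 then if s3 = j3 then if t = l1 then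
      of_bool (i1 = j1 \<and> i2 = j2 \<and> i3 = j3 \<and> l1 = l2 \<and> l2 = l3) else 0 else 0 else 0 else 0)"
    for s1 s2 s3 t
    by (auto simp: pure_tensor_def basis_vec_def)
  then show ?thesis
    unfolding dome_def by (auto simp: sum_if_const simp del: atLeastAtMost_iff cong: if_cong)
qed

lemma prod_of_bool:
  "finite A \<Longrightarrow> (\<Prod>p\<in>A. of_bool (P p) :: complex) = of_bool (\<forall>p\<in>A. P p)"
  by (induction A rule: finite_induct) auto

text \<open>
  Expanding the \<open>N\<close>-th power of a direct sum of two tensors gives one summand for every set \<open>S\<close> of
  positions, namely the positions in which the first tensor is chosen. For \<open>card S = k\<close> this summand
  is a dome with edge labels \<open>S \<rightarrow>\<^sub>E I\<close> and hyperedge labels \<open>({..<N} - S) \<rightarrow>\<^sub>E \<Lambda>\<close>, and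
  summands for different \<open>S\<close> share no coordinates in any leg.
\<close>

lemma border_le_copies_dome:
  assumes R: "dome_sum I \<Lambda> \<in> border_le R" and fin: "finite I" "finite \<Lambda>"
  shows "copies (N choose k) (dome (card I ^ k) (card \<Lambda> ^ (N - k))) \<in> border_le (R ^ N)"
proof -
  define K where "K = {S. S \<subseteq> {..<N} \<and> card S = k}"
  define C where "C = N choose k"
  define m where "m = card I ^ k"
  define L where "L = card \<Lambda> ^ (N - k)"
  have K: "S \<subseteq> {..<N}" "finite S" "card S = k" if "S \<in> K" for S
    using that by (auto simp: K_def intro: finite_subset)
  have "finite K" "card K = C"
    using n_subsets[of "{..<N}" k] by (auto simp: K_def C_def)
  then obtain e where e: "bij_betw e {..<C} K"
    using ex_bij_betw_nat_finite atLeast0LessThan by metis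
  have "\<exists>\<phi>. bij_betw \<phi> {1..m} (S \<rightarrow>\<^sub>E I)" if "S \<in> K" for S
    using ex_bij_betw_nat_finite_1[of "S \<rightarrow>\<^sub>E I"] K[OF that] fin
    by (simp add: finite_PiE card_PiE m_def)
  then obtain \<phi> where \<phi>: "bij_betw (\<phi> S) {1..m} (S \<rightarrow>\<^sub>E I)" if "S \<in> K" for S
    by metis
  have "\<exists>\<psi>. bij_betw \<psi> {1..L} (({..<N} - S) \<rightarrow>\<^sub>E \<Lambda>)" if "S \<in> K" for S
    using ex_bij_betw_nat_finite_1[of "({..<N} - S) \<rightarrow>\<^sub>E \<Lambda>"] K[OF that] fin
    by (simp add: finite_PiE card_PiE L_def card_Diff_subset)
  then obtain \<psi> where \<psi>: "bij_betw (\<psi> S) {1..L} (({..<N} - S) \<rightarrow>\<^sub>E \<Lambda>)" if "S \<in> K" for S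
    by metis
  \<comment> \<open>The coordinate of the power that corresponds to a coordinate in copy \<open>c\<close>.\<close>
  define leg where "leg A p = (case A of (c, i, l) \<Rightarrow>
      if p \<in> e c then Inl (\<phi> (e c) i p) else Inr (\<psi> (e c) l p))" for A p
  define leg4 where "leg4 A p = (case A of (c, j1, j2, j3) \<Rightarrow>
      if p \<in> e c then Inl (\<phi> (e c) j1 p, \<phi> (e c) j2 p, \<phi> (e c) j3 p) else Inr ())" for A p
  define \<alpha> :: "nat \<times> nat \<times> nat \<Rightarrow> complex" where
    "\<alpha> A = (case A of (c, i, l) \<Rightarrow> of_bool (c < C \<and> i \<in> {1..m} \<and> l \<in> {1..L}))" for A
  define \<delta> :: "nat \<times> nat \<times> nat \<times> nat \<Rightarrow> complex" where
    "\<delta> A = (case A of (c, j1, j2, j3) \<Rightarrow>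
        of_bool (c < C \<and> j1 \<in> {1..m} \<and> j2 \<in> {1..m} \<and> j3 \<in> {1..m}))" for A
  have eK: "e c \<in> K" if "c < C" for c using e that by (auto simp: bij_betw_def)
  have e_eq: "c = c'" if "c < C" "c' < C" "\<And>p. p < N \<Longrightarrow> p \<in> e c \<longleftrightarrow> p \<in> e c'" for c c'
  proof -
    have "e c = e c'" using K(1)[OF eK[OF that(1)]] K(1)[OF eK[OF that(2)]] that(3) by blast
    then show ?thesis
      using inj_onD[OF bij_betw_imp_inj_on[OF e]] that(1,2) by simp
  qed
  have \<phi>_mem: "\<phi> (e c) i \<in> e c \<rightarrow>\<^sub>E I" if "c < C" "i \<in> {1..m}" for c i
    using \<phi>[OF eK[OF that(1)]] that(2) by (auto simp: bij_betw_def)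
  have \<psi>_mem: "\<psi> (e c) l \<in> ({..<N} - e c) \<rightarrow>\<^sub>E \<Lambda>" if "c < C" "l \<in> {1..L}" for c l
    using \<psi>[OF eK[OF that(1)]] that(2) by (auto simp: bij_betw_def)
  have \<phi>_eq: "i = j" if "c < C" "i \<in> {1..m}" "j \<in> {1..m}" "\<And>p. p \<in> e c \<Longrightarrow> \<phi> (e c) i p = \<phi> (e c) j p"
    for c i j
    by (rule inj_onD[OF bij_betw_imp_inj_on[OF \<phi>[OF eK[OF that(1)]]]
          PiE_ext[OF \<phi>_mem[OF that(1,2)] \<phi>_mem[OF that(1,3)] that(4)] that(2,3)])
  have \<psi>_eq: "l = j" if "c < C" "l \<in> {1..L}" "j \<in> {1..L}"
    "\<And>p. p \<in> {..<N} - e c \<Longrightarrow> \<psi> (e c) l p = \<psi> (e c) j p" for c l j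
    by (rule inj_onD[OF bij_betw_imp_inj_on[OF \<psi>[OF eK[OF that(1)]]]
          PiE_ext[OF \<psi>_mem[OF that(1,2)] \<psi>_mem[OF that(1,3)] that(4)] that(2,3)])
  show ?thesis
    unfolding C_def[symmetric] m_def[symmetric] L_def[symmetric]
  proof (rule border_le_pullback[OF border_le_kron_power[OF R], where \<alpha>=\<alpha> and \<beta>=\<alpha> and \<gamma>=\<alpha>
        and \<delta>=\<delta> and f=leg and g=leg and h=leg and k=leg4])
    fix a b c :: "nat \<times> nat \<times> nat" and D :: "nat \<times> nat \<times> nat \<times> nat"
    obtain c1 i1 l1 where a: "a = (c1, i1, l1)" by (cases a)
    obtain c2 i2 l2 where b: "b = (c2, i2, l2)" by (cases b)
    obtain c3 i3 l3 where c: "c = (c3, i3, l3)" by (cases c)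
    obtain c4 j1 j2 j3 where d: "D = (c4, j1, j2, j3)" by (cases D)
    define match where "match p \<longleftrightarrow>
        (p \<in> e c1 \<longleftrightarrow> p \<in> e c4) \<and> (p \<in> e c2 \<longleftrightarrow> p \<in> e c4) \<and> (p \<in> e c3 \<longleftrightarrow> p \<in> e c4) \<and>
        (p \<in> e c4 \<longrightarrow> \<phi> (e c1) i1 p = \<phi> (e c4) j1 p \<and> \<phi> (e c2) i2 p = \<phi> (e c4) j2 p
            \<and> \<phi> (e c3) i3 p = \<phi> (e c4) j3 p) \<and>
        (p \<notin> e c4 \<longrightarrow> \<psi> (e c1) l1 p = \<psi> (e c2) l2 p \<and> \<psi> (e c2) l2 p = \<psi> (e c3) l3 p)" for p
    show "copies C (dome m L) a b c D
      = \<alpha> a * \<alpha> b * \<alpha> c * \<delta> D * kron_power N (dome_sum I \<Lambda>) (leg a) (leg b) (leg c) (leg4 D)"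
    proof (cases "\<alpha> a \<noteq> 0 \<and> \<alpha> b \<noteq> 0 \<and> \<alpha> c \<noteq> 0 \<and> \<delta> D \<noteq> 0")
      case False
      then show ?thesis by (auto simp: a b c d \<alpha>_def \<delta>_def copies_def dome_entry)
    next
      case True
      then have *: "c1 < C" "i1 \<in> {1..m}" "l1 \<in> {1..L}" "c2 < C" "i2 \<in> {1..m}" "l2 \<in> {1..L}"
        "c3 < C" "i3 \<in> {1..m}" "l3 \<in> {1..L}"
        "c4 < C" "j1 \<in> {1..m}" "j2 \<in> {1..m}" "j3 \<in> {1..m}"
        by (auto simp: a b c d \<alpha>_def \<delta>_def)
      have "dome_sum I \<Lambda> (leg a p) (leg b p) (leg c p) (leg4 D p) = of_bool (match p)" if "p < N" for p
        using that PiE_mem[OF \<phi>_mem[OF *(10,11)]] PiE_mem[OF \<phi>_mem[OF *(10,12)]]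
          PiE_mem[OF \<phi>_mem[OF *(10,13)]] PiE_mem[OF \<psi>_mem[OF *(1,3)], of p]
        by (auto simp: a b c d leg_def leg4_def dome_sum_def match_def)
      then have "kron_power N (dome_sum I \<Lambda>) (leg a) (leg b) (leg c) (leg4 D)
          = (\<Prod>p<N. of_bool (match p))"
        by (simp add: kron_power_def)
      also have "\<dots> = of_bool (\<forall>p\<in>{..<N}. match p)" by (simp add: prod_of_bool)
      also have "(\<forall>p\<in>{..<N}. match p) \<longleftrightarrow> c1 = c2 \<and> c2 = c3 \<and> c3 = c4 \<and> i1 = j1 \<and> i2 = j2 \<and> i3 = j3
          \<and> l1 = l2 \<and> l2 = l3" (is "?A \<longleftrightarrow> ?B")
      proof
        assume ?A
        then have M: "match p" if "p < N" for p using that by simp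
        have cc: "c1 = c4" "c2 = c4" "c3 = c4"
          using M * by (auto intro!: e_eq simp: match_def)
        have sub: "p < N" if "p \<in> e c4" for p using K(1)[OF eK[OF *(10)]] that by auto
        have "i1 = j1" "i2 = j2" "i3 = j3"
          using M sub * cc by (auto intro!: \<phi>_eq[of c4] simp: match_def)
        moreover have "l1 = l2" "l2 = l3"
          using M * cc by (auto intro!: \<psi>_eq[of c4] simp: match_def)
        ultimately show ?B using cc by simp
      qed (auto simp: match_def)
      finally show ?thesis
        using * by (auto simp: a b c d \<alpha>_def \<delta>_def copies_def dome_entry)
    qed
  qed
qed

text \<open>
  A power of a dome is a dome whose labels are tuples; any smaller dome is obtained by discarding
  labels. The discarding is what makes rounding of the exponents harmless later on.
\<close>

lemma border_le_dome_of_kron_power: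
  assumes r: "kron_power s (dome m L) \<in> border_le r" and "a \<le> m ^ s" "b \<le> L ^ s"
  shows "dome a b \<in> border_le r"
proof -
  let ?E = "\<lambda>n. {..<s} \<rightarrow>\<^sub>E {1..n::nat}"
  have ex: "\<exists>\<phi>. \<phi> ` {1..a} \<subseteq> ?E n \<and> inj_on \<phi> {1..a}" if "a \<le> n ^ s" for a n :: nat
    by (rule card_le_inj) (use that in \<open>auto simp: card_PiE finite_PiE\<close>)
  obtain \<phi> where \<phi>: "\<phi> ` {1..a} \<subseteq> ?E m" "inj_on \<phi> {1..a}" using ex[OF assms(2)] by blast
  obtain \<psi> where \<psi>: "\<psi> ` {1..b} \<subseteq> ?E L" "inj_on \<psi> {1..b}" using ex[OF assms(3)] by blast
  have \<phi>_mem: "\<phi> i \<in> ?E m" if "i \<in> {1..a}" for i using \<phi>(1) that by blast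
  have \<psi>_mem: "\<psi> i \<in> ?E L" if "i \<in> {1..b}" for i using \<psi>(1) that by blast
  have \<phi>_eq: "i = j" if "i \<in> {1..a}" "j \<in> {1..a}" "\<And>p. p \<in> {..<s} \<Longrightarrow> \<phi> i p = \<phi> j p" for i j
    using inj_onD[OF \<phi>(2) PiE_ext[OF \<phi>_mem[OF that(1)] \<phi>_mem[OF that(2)] that(3)]] that(1,2) by simp
  have \<psi>_eq: "i = j" if "i \<in> {1..b}" "j \<in> {1..b}" "\<And>p. p \<in> {..<s} \<Longrightarrow> \<psi> i p = \<psi> j p" for i j
    using inj_onD[OF \<psi>(2) PiE_ext[OF \<psi>_mem[OF that(1)] \<psi>_mem[OF that(2)] that(3)]] that(1,2) by simp
  define \<alpha> :: "nat \<times> nat \<Rightarrow> complex" where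
    "\<alpha> A = of_bool (fst A \<in> {1..a} \<and> snd A \<in> {1..b})" for A
  define \<delta> :: "nat \<times> nat \<times> nat \<Rightarrow> complex" where
    "\<delta> A = of_bool (fst A \<in> {1..a} \<and> fst (snd A) \<in> {1..a} \<and> snd (snd A) \<in> {1..a})" for A
  define leg where "leg A p = (\<phi> (fst A) p, \<psi> (snd A) p)" for A p
  define leg4 where "leg4 A p = (\<phi> (fst A) p, \<phi> (fst (snd A)) p, \<phi> (snd (snd A)) p)" for A p
  show ?thesis
  proof (rule border_le_pullback[OF r, where \<alpha>=\<alpha> and \<beta>=\<alpha> and \<gamma>=\<alpha>
        and \<delta>=\<delta> and f=leg and g=leg and h=leg and k=leg4])
    fix A B C :: "nat \<times> nat" and D :: "nat \<times> nat \<times> nat"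
    obtain i1 l1 where A: "A = (i1, l1)" by (cases A)
    obtain i2 l2 where B: "B = (i2, l2)" by (cases B)
    obtain i3 l3 where C: "C = (i3, l3)" by (cases C)
    obtain j1 j2 j3 where D: "D = (j1, j2, j3)" by (cases D)
    show "dome a b A B C D
      = \<alpha> A * \<alpha> B * \<alpha> C * \<delta> D * kron_power s (dome m L) (leg A) (leg B) (leg C) (leg4 D)"
    proof (cases "\<alpha> A \<noteq> 0 \<and> \<alpha> B \<noteq> 0 \<and> \<alpha> C \<noteq> 0 \<and> \<delta> D \<noteq> 0")
      case False
      then show ?thesis by (auto simp: A B C D \<alpha>_def \<delta>_def dome_entry)
    next
      case True
      then have *: "i1 \<in> {1..a}" "l1 \<in> {1..b}" "i2 \<in> {1..a}" "l2 \<in> {1..b}" "i3 \<in> {1..a}" "l3 \<in> {1..b}"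
        "j1 \<in> {1..a}" "j2 \<in> {1..a}" "j3 \<in> {1..a}"
        by (auto simp: A B C D \<alpha>_def \<delta>_def)
      define match where "match p \<longleftrightarrow> \<phi> i1 p = \<phi> j1 p \<and> \<phi> i2 p = \<phi> j2 p \<and> \<phi> i3 p = \<phi> j3 p
        \<and> \<psi> l1 p = \<psi> l2 p \<and> \<psi> l2 p = \<psi> l3 p" for p
      have "dome m L (leg A p) (leg B p) (leg C p) (leg4 D p) = of_bool (match p)" if "p < s" for p
        using that PiE_mem[OF \<phi>_mem[OF *(7)], of p] PiE_mem[OF \<phi>_mem[OF *(8)], of p]
          PiE_mem[OF \<phi>_mem[OF *(9)], of p] PiE_mem[OF \<psi>_mem[OF *(2)], of p]
        unfolding leg_def leg4_def dome_entry by (simp add: A B C D match_def)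
      then have "kron_power s (dome m L) (leg A) (leg B) (leg C) (leg4 D)
          = (\<Prod>p<s. of_bool (match p))"
        by (simp add: kron_power_def)
      also have "\<dots> = of_bool (\<forall>p\<in>{..<s}. match p)" by (simp add: prod_of_bool)
      also have "(\<forall>p\<in>{..<s}. match p) \<longleftrightarrow> i1 = j1 \<and> i2 = j2 \<and> i3 = j3 \<and> l1 = l2 \<and> l2 = l3"
        using \<phi>_eq[of i1 j1] \<phi>_eq[of i2 j2] \<phi>_eq[of i3 j3] \<psi>_eq[of l1 l2] \<psi>_eq[of l2 l3] *
        unfolding match_def by blast
      finally show ?thesis
        using * by (auto simp: A B C D \<alpha>_def \<delta>_def dome_entry)
    qed
  qed
qed

section \<open>From the closure to the border rank\<close>

lemma border_rank_le:
  fixes T :: "('a :: countable, 'b :: countable, 'c :: countable, 'd :: countable) tensor4"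
  assumes T: "T \<in> border_le r" and supp: "T \<in> tensor_space A B C D"
  shows "border_rank A B C D T \<le> r"
proof -
  obtain X where X: "\<And>j. X j \<in> rank_le r" "X \<longlonglongrightarrow> T"
    using T unfolding border_le_def closure_sequential by blast
  \<comment> \<open>The approximations need not vanish outside the box, so they are cut off there.\<close>
  define box where "box a b c d \<longleftrightarrow> a \<in> A \<and> b \<in> B \<and> c \<in> C \<and> d \<in> D" for a b c d
  define Y where "Y j a b c d = of_bool (box a b c d) * X j a b c d" for j a b c d
  have space: "Y j \<in> tensor_space A B C D" for j
    by (auto simp: Y_def tensor_space_def box_def)
  have rank: "tensor_rank A B C D (Y j) \<le> r" for j
  proof -
    obtain u v w x where S: "\<And>a b c d. X j a b c d = (\<Sum>s<r. pure_tensor (u s) (v s) (w s) (x s) a b c d)"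
      using X(1)[of j] by (auto simp: rank_le_def)
    show ?thesis
      unfolding tensor_rank_def
    proof (rule Least_le, intro exI conjI allI impI)
      show "(\<lambda>z. of_bool (z \<in> A) * u s z) \<in> vec_space A" "(\<lambda>z. of_bool (z \<in> B) * v s z) \<in> vec_space B"
        "(\<lambda>z. of_bool (z \<in> C) * w s z) \<in> vec_space C" "(\<lambda>z. of_bool (z \<in> D) * x s z) \<in> vec_space D" for s
        by (auto simp: vec_space_def)
      show "Y j = (\<lambda>a b c d. \<Sum>s<r. pure_tensor (\<lambda>z. of_bool (z \<in> A) * u s z)
          (\<lambda>z. of_bool (z \<in> B) * v s z) (\<lambda>z. of_bool (z \<in> C) * w s z)
          (\<lambda>z. of_bool (z \<in> D) * x s z) a b c d)"
        by (intro ext) (auto simp: Y_def S pure_tensor_def box_def)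
    qed
  qed
  have lim: "(\<lambda>j. Y j a b c d) \<longlonglongrightarrow> T a b c d" for a b c d
  proof (cases "box a b c d")
    case True
    have "(\<lambda>j. X j a b c d) \<longlonglongrightarrow> T a b c d"
      by (rule continuous_on_tendsto_compose[OF continuous_on_entry X(2)]) auto
    then show ?thesis using True by (simp add: Y_def)
  next
    case False
    then have "T a b c d = 0" using supp by (auto simp: box_def tensor_space_def)
    then show ?thesis using False by (simp add: Y_def)
  qed
  \<comment> \<open>The ranks of the approximations are at most \<open>r\<close> but may vary; some value occurs infinitely often.\<close>
  let ?rk = "\<lambda>j. tensor_rank A B C D (Y j)"
  have "finite (range ?rk)"
    by (rule finite_subset[of _ "{..r}"]) (use rank in auto)
  then obtain j0 where "infinite {j. ?rk j = ?rk j0}"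
    using pigeonhole_infinite[of UNIV ?rk] by auto
  then obtain \<sigma> :: "nat \<Rightarrow> nat" where \<sigma>: "strict_mono \<sigma>" "\<And>n. ?rk (\<sigma> n) = ?rk j0"
    using infinite_enumerate[of "{j. ?rk j = ?rk j0}"] by auto
  have "border_rank A B C D T \<le> ?rk j0"
    unfolding border_rank_def
  proof (rule Least_le, intro exI[of _ "\<lambda>n. Y (\<sigma> n)"] conjI allI)
    show "(\<lambda>n. Y (\<sigma> n) a b c d) \<longlonglongrightarrow> T a b c d" for a b c d
      using LIMSEQ_subseq_LIMSEQ[OF lim \<sigma>(1)] by (simp add: comp_def)
  qed (use space \<sigma>(2) in auto)
  then show ?thesis using rank[of j0] by linarith
qed

lemma dome_border_rank_le:
  assumes "dome m L \<in> border_le r"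
  shows "dome_border_rank m L \<le> r"
  unfolding dome_border_rank_def
  by (rule border_rank_le[OF assms]) (auto simp: tensor_space_def dome_entry)

lemma dome_border_rank_block:
  assumes sum: "dome_sum I \<Lambda> \<in> border_le R" "finite I" "finite \<Lambda>"
    and k: "k \<le> t" and Q: "R ^ t \<le> Q * (t choose k)"
    and a: "a \<le> (card I ^ k) ^ s" and b: "b \<le> (card \<Lambda> ^ (t - k)) ^ s"
  shows "dome_border_rank a b \<le> Q ^ s * (t choose k)"
  by (rule dome_border_rank_le[OF border_le_dome_of_kron_power[OF
        border_le_kron_power_of_copies[OF border_le_copies_dome[OF sum] Q] a b]])
     (use k in simp)


section \<open>Binomial coefficients and entropy\<close>

text \<open>
  The largest term of the binomial distribution: it is at least the average \<open>1 / (t + 1)\<close>, and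
  comparing it with its two neighbours locates it.
\<close>

lemma binomial_mode:
  fixes p :: real
  assumes p: "0 < p" "p < 1"
  obtains k where "k \<le> t" "real k \<le> (real t + 1) * p" "(real t + 1) * p \<le> real k + 1"
    "1 \<le> (real t + 1) * (real (t choose k) * p ^ k * (1 - p) ^ (t - k))"
proof -
  define g where "g k = real (t choose k) * p ^ k * (1 - p) ^ (t - k)" for k
  have "Max (g ` {..t}) \<in> g ` {..t}" by (rule Max_in) auto
  then obtain k where k: "Max (g ` {..t}) = g k" "k \<in> {..t}" by (rule imageE)
  have max: "g j \<le> g k" if "j \<le> t" for j
    unfolding k(1)[symmetric] using that by (intro Max_ge) auto
  have "1 = (\<Sum>j\<le>t. g j)"
    using binomial_ring[of p "1 - p" t] by (simp add: g_def)
  also have "\<dots> \<le> (real t + 1) * g k"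
    using sum_bounded_above[of "{..t}" g "g k"] max by (simp add: add.commute)
  finally have large: "1 \<le> (real t + 1) * g k" .
  \<comment> \<open>The quotient of two consecutive terms is \<open>(t - j) p / ((j + 1) (1 - p))\<close>.\<close>
  have step: "g (Suc j) * ((real j + 1) * (1 - p)) = g j * ((real t - real j) * p)" if "j < t" for j
  proof -
    have "Suc j * (t choose Suc j) = (t choose j) * (t - j)"
      using binomial_absorb_comp[of t j]
      by (metis Suc_times_binomial_eq binomial_absorption mult.commute)
    then have "real (Suc j * (t choose Suc j)) = real ((t choose j) * (t - j))" by simp
    then have "(real j + 1) * real (t choose Suc j) = real (t choose j) * (real t - real j)"
      using that by (simp add: of_nat_diff algebra_simps)
    then have "((real j + 1) * real (t choose Suc j)) * (p ^ Suc j * (1 - p) ^ (t - j))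
        = real (t choose j) * (real t - real j) * (p ^ Suc j * (1 - p) ^ (t - j))" by simp
    moreover have "t - j = Suc (t - Suc j)" using that by simp
    ultimately show ?thesis by (simp add: g_def mult_ac)
  qed
  have pos: "g j > 0" if "j \<le> t" for j
    using that p by (simp add: g_def)
  have "real k \<le> (real t + 1) * p"
  proof (cases k)
    case (Suc j)
    then have j: "j < t" using k by simp
    have "g j * ((real j + 1) * (1 - p)) \<le> g (Suc j) * ((real j + 1) * (1 - p))"
      using max[of j] j p Suc by (intro mult_right_mono) auto
    then have "(real j + 1) * (1 - p) \<le> (real t - real j) * p"
      unfolding step[OF j] using pos[of j] j by simp
    then show ?thesis by (simp add: Suc algebra_simps)
  qed (use p in simp)
  moreover have "(real t + 1) * p \<le> real k + 1"
  proof (cases "k = t")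
    case True
    then show ?thesis using p mult_left_le[of p "real t + 1"] by simp
  next
    case False
    then have j: "k < t" using k by simp
    have "g (Suc k) * ((real k + 1) * (1 - p)) \<le> g k * ((real k + 1) * (1 - p))"
      using max[of "Suc k"] j p by (intro mult_right_mono) auto
    then have "(real t - real k) * p \<le> (real k + 1) * (1 - p)"
      unfolding step[OF j] using pos[of k] j by simp
    then show ?thesis by (simp add: algebra_simps)
  qed
  ultimately show ?thesis using that k(2) large by (simp add: g_def)
qed

text \<open>
  At the mode \<open>k\<close>, the probability \<open>p\<^sup>k (1 - p)\<^bsup>t - k\<^esup>\<close> of a single outcome is
  \<open>2\<close> to the power \<open>- t h(p)\<close> up to a constant factor, since \<open>k\<close> and \<open>p t\<close> differ by at most 1. So the
  binomial coefficient is bounded below without any continuity argument for the entropy.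
\<close>

lemma binomial_entropy_lower_bound:
  fixes p :: real
  assumes p: "0 < p" "p < 1"
  obtains k where "k \<le> t" "p * real t - 1 \<le> real k" "(1 - p) * real t - 1 \<le> real (t - k)"
    "real t * binary_entropy p + log 2 p + log 2 (1 - p) - log 2 (real t + 1)
      \<le> log 2 (real (t choose k))"
proof -
  obtain k where k: "k \<le> t" "real k \<le> (real t + 1) * p" "(real t + 1) * p \<le> real k + 1"
    "1 \<le> (real t + 1) * (real (t choose k) * p ^ k * (1 - p) ^ (t - k))"
    using binomial_mode[OF p] .
  have lo: "p * real t - 1 \<le> real k" using k(3) p by (simp add: algebra_simps)
  have hi: "(1 - p) * real t - 1 \<le> real (t - k)" 
    using k(1,2) p by (simp add: of_nat_diff algebra_simps)
  have neg: "log 2 p \<le> 0" "log 2 (1 - p) \<le> 0" using p by simp_all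
  have "0 \<le> log 2 ((real t + 1) * (real (t choose k) * p ^ k * (1 - p) ^ (t - k)))"
    using k(4) by simp
  also have "\<dots> = log 2 (real t + 1) + log 2 (real (t choose k)) + real k * log 2 p
      + real (t - k) * log 2 (1 - p)"
    using p k(1) by (simp add: log_mult log_nat_power)
  finally have "0 \<le> log 2 (real t + 1) + log 2 (real (t choose k)) + real k * log 2 p
      + real (t - k) * log 2 (1 - p)" .
  moreover have "real k * log 2 p \<le> (p * real t - 1) * log 2 p"
    using lo neg by (intro mult_right_mono_neg)
  moreover have "real (t - k) * log 2 (1 - p) \<le> ((1 - p) * real t - 1) * log 2 (1 - p)"
    using hi neg by (intro mult_right_mono_neg)
  ultimately have "real t * binary_entropy p + log 2 p + log 2 (1 - p) - log 2 (real t + 1)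
      \<le> log 2 (real (t choose k))"
    by (simp add: binary_entropy_def algebra_simps)
  then show ?thesis using that k(1) lo hi by blast
qed

section \<open>The exponent of the dome tensor\<close>

text \<open>
  For each \<open>\<epsilon>\<close> a bound with error \<open>\<epsilon> N + O(1)\<close> suffices, although the implied constant may grow as
  \<open>\<epsilon>\<close> shrinks: the smallest admissible error term is then sublinear.
\<close>

lemma dome_exponent_leI:
  assumes bound: "\<And>\<epsilon>. \<epsilon> > 0 \<Longrightarrow> \<exists>B. \<forall>N a b. N > 0 \<longrightarrow> real a = m ^ N \<longrightarrow> real b = L ^ N \<longrightarrow>
      real (dome_border_rank a b) \<le> 2 powr ((e + \<epsilon>) * real N + B)"
  shows "dome_exponent_le m L e"
proof -
  define ok where "ok N \<longleftrightarrow> N > 0 \<and> real (nat \<lfloor>m ^ N\<rfloor>) = m ^ N \<and> real (nat \<lfloor>L ^ N\<rfloor>) = L ^ N" for N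
  define r where "r N = real (dome_border_rank (nat \<lfloor>m ^ N\<rfloor>) (nat \<lfloor>L ^ N\<rfloor>))" for N
  \<comment> \<open>For given \<open>N\<close> there is at most one pair of integer weights, so \<open>f\<close> can be written down.\<close>
  define f where "f N = (if ok N \<and> r N > 0 then max 0 (log 2 (r N) - e * real N) else 0)" for N
  have "f \<in> o(\<lambda>N. real N)"
  proof (rule landau_o.smallI)
    fix c :: real assume c: "c > 0"
    obtain B where B: "\<And>N a b. N > 0 \<Longrightarrow> real a = m ^ N \<Longrightarrow> real b = L ^ N \<Longrightarrow>
        real (dome_border_rank a b) \<le> 2 powr ((e + c / 2) * real N + B)"
      using bound[of "c / 2"] c by auto
    have "norm (f N) \<le> c * norm (real N)" if N: "real N \<ge> 2 * B / c" for N
    proof (cases "ok N \<and> r N > 0")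
      case True
      then have "r N \<le> 2 powr ((e + c / 2) * real N + B)"
        unfolding r_def ok_def by (intro B) auto
      then have "log 2 (r N) \<le> (e + c / 2) * real N + B"
        using True by (simp add: log_le_iff)
      moreover have "B \<le> c / 2 * real N" using N c by (simp add: field_simps)
      ultimately show ?thesis using True c by (simp add: f_def algebra_simps)
    qed (use c in \<open>auto simp: f_def\<close>)
    then show "\<forall>\<^sub>F N in sequentially. norm (f N) \<le> c * norm (real N)"
      using eventually_mono[OF filterlim_real_sequentially[unfolded filterlim_at_top, rule_format, of "2 * B / c"]]
      by auto
  qed
  moreover have "real (dome_border_rank a b) \<le> 2 powr (e * real N + f N)"
    if "N > 0" "real a = m ^ N" "real b = L ^ N" for N a b
  proof (cases "dome_border_rank a b = 0")
    case False
    have ab: "nat \<lfloor>m ^ N\<rfloor> = a" "nat \<lfloor>L ^ N\<rfloor> = b" by (simp_all flip: that(2,3))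
    then have "ok N" "r N = real (dome_border_rank a b)" "r N > 0"
      using that False by (simp_all add: ok_def r_def)
    then have "log 2 (real (dome_border_rank a b)) \<le> e * real N + f N"
      by (simp add: f_def)
    then show ?thesis using False by (simp add: log_le_iff)
  qed simp
  ultimately show ?thesis unfolding dome_exponent_le_def by blast
qed

text \<open>
  Fix a block length \<open>t\<close>. The \<open>t\<close>-th power of the direct sum contains \<open>C = t choose k\<close> copies of one dome,
  where \<open>k\<close> is about \<open>p t\<close>, so in high powers each factor of this dome costs about
  \<open>R\<^sup>t / C\<close>, which is 2 to the power \<open>t (log R - h(p))\<close> up to a factor polynomial in \<open>t\<close>. To reach
  weights with exponent \<open>N\<close>, slightly more than \<open>N / t\<close> factors are used.
\<close>

lemma dome_exponent_le_of_dome_sum: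
  fixes p :: real
  assumes sum: "dome_sum I \<Lambda> \<in> border_le R" and fin: "finite I" "finite \<Lambda>"
    and ne: "card I \<ge> 1" "card \<Lambda> \<ge> 1" and R: "R \<ge> 2" and p: "0 < p" "p < 1"
  shows "dome_exponent_le (real (card I) powr p) (real (card \<Lambda>) powr (1 - p))
    (log 2 (real R) - binary_entropy p)"
proof (rule dome_exponent_leI)
  fix \<epsilon> :: real assume \<epsilon>: "\<epsilon> > 0"
  define rate where "rate = log 2 (real R) - binary_entropy p"
  \<comment> \<open>Rounding \<open>p t\<close> and \<open>(1 - p) t\<close> loses at most 1 in each; a block of length \<open>t\<close> therefore covers
    at least \<open>t - K\<close> of the required exponent \<open>N\<close> in both weights.\<close>
  define K where "K = 1 / min p (1 - p)"
  have K: "p * K \<ge> 1" "(1 - p) * K \<ge> 1"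
    using p by (auto simp: K_def min_def field_simps)
  define c where "c = 1 - log 2 p - log 2 (1 - p)"
  have "\<forall>\<^sub>F t :: nat in sequentially. rate * K + c + log 2 (real t + 1) \<le> \<epsilon> * (real t - K)"
    using \<epsilon> by real_asymp
  moreover have "\<forall>\<^sub>F t :: nat in sequentially. real t > K"
    by real_asymp
  ultimately have "\<forall>\<^sub>F t :: nat in sequentially.
      rate * K + c + log 2 (real t + 1) \<le> \<epsilon> * (real t - K) \<and> real t > K"
    by (rule eventually_conj)
  then obtain t :: nat where t: "rate * K + c + log 2 (real t + 1) \<le> \<epsilon> * (real t - K)" "real t > K"
    using eventually_happens by fastforce
  \<comment> \<open>An upper bound for the logarithmic cost \<open>G\<close> of one block.\<close>
  define E where "E = real t * rate + c + log 2 (real t + 1)"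
  have E: "E \<le> (rate + \<epsilon>) * (real t - K)" using t(1) by (simp add: E_def algebra_simps)
  obtain k where k: "k \<le> t" "p * real t - 1 \<le> real k" "(1 - p) * real t - 1 \<le> real (t - k)"
    "real t * binary_entropy p + log 2 p + log 2 (1 - p) - log 2 (real t + 1)
      \<le> log 2 (real (t choose k))"
    using binomial_entropy_lower_bound[OF p] .
  define C where "C = t choose k"
  have C: "C > 0" using k(1) by (simp add: C_def)
  have C_le: "C \<le> 2 ^ t" unfolding C_def by (rule binomial_le_pow2)
  also have "(2 :: nat) ^ t \<le> R ^ t" by (rule power_mono[OF R]) simp
  finally have C_le_R: "C \<le> R ^ t" .
  define Q where "Q = nat \<lceil>real R ^ t / real C\<rceil>"
  \<comment> \<open>The summand 1 pays for rounding up: \<open>Q\<close> is at most twice \<open>R\<^sup>t / C\<close> because \<open>C\<close> is at most \<open>R\<^sup>t\<close>.\<close>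
  define G where "G = 1 + real t * log 2 (real R) - log 2 (real C)"
  have "real R ^ t / real C \<le> real Q" unfolding Q_def by linarith
  then have "real (R ^ t) \<le> real (Q * C)" using C by (simp add: field_simps)
  then have Q: "R ^ t \<le> Q * (t choose k)" unfolding C_def by linarith
  have "1 \<le> real R ^ t / real C" using C C_le_R by (simp flip: of_nat_power)
  then have "real Q \<le> 2 * (real R ^ t / real C)" unfolding Q_def by linarith
  also have "2 * (real R ^ t / real C) = 2 powr G"
  proof -
    have "2 powr (real t * log 2 (real R)) = real R ^ t"
      using R by (subst mult.commute) (simp add: powr_realpow flip: powr_powr)
    then show ?thesis using C by (simp add: G_def powr_add powr_diff)
  qed
  finally have Q_le: "real Q \<le> 2 powr G" .
  have "log 2 (real C) \<le> log 2 (real (R ^ t))"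
    using C C_le_R R by (subst log_le_cancel_iff) auto
  then have G0: "G \<ge> 0" using R by (simp add: G_def log_nat_power)
  have GE: "G \<le> E" using k(4) by (simp add: G_def E_def C_def rate_def c_def algebra_simps)
  show "\<exists>B. \<forall>N a b. N > 0 \<longrightarrow> real a = (real (card I) powr p) ^ N \<longrightarrow>
      real b = (real (card \<Lambda>) powr (1 - p)) ^ N \<longrightarrow>
      real (dome_border_rank a b) \<le> 2 powr ((log 2 (real R) - binary_entropy p + \<epsilon>) * real N + B)"
  proof (intro exI allI impI)
    fix N a b :: nat
    assume N: "N > 0" and a: "real a = (real (card I) powr p) ^ N"
      and b: "real b = (real (card \<Lambda>) powr (1 - p)) ^ N"
    define s where "s = nat \<lceil>real N / (real t - K)\<rceil>"
    have s: "real N / (real t - K) \<le> real s" "real s \<le> real N / (real t - K) + 1"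
      using t(2) unfolding s_def by (linarith, simp) 
    have Ns: "real N \<le> (real t - K) * real s" using s(1) t(2) by (simp add: field_simps)
    have power_bound: "x \<le> (d ^ j) ^ s"
      if "real x = (real d powr \<theta>) ^ N" "d \<ge> 1" "0 < \<theta>" "\<theta> * K \<ge> 1" "\<theta> * real t - 1 \<le> real j"
      for x d j :: nat and \<theta> :: real
    proof -
      have "\<theta> * real N \<le> \<theta> * ((real t - K) * real s)"
        using Ns that(3) by (intro mult_left_mono) auto
      also have "\<dots> \<le> real j * real s"
        using that(4,5) mult_right_mono[of "\<theta> * real t - \<theta> * K" "real j" "real s"]
        by (simp add: algebra_simps)
      finally have "\<theta> * real N \<le> real (j * s)" by simp
      then have "real x \<le> real d powr real (j * s)"
        unfolding that(1) using that(2) by (subst powr_power) (auto intro!: powr_mono simp: mult.commute)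
      also have "\<dots> = real ((d ^ j) ^ s)"
        using that(2) by (subst powr_realpow) (auto simp: power_mult)
      finally show ?thesis by linarith
    qed
    have "dome_border_rank a b \<le> Q ^ s * (t choose k)"
      using dome_border_rank_block[OF sum fin k(1) Q] power_bound[OF a] power_bound[OF b] ne p K k(2,3)
      by simp
    then have "real (dome_border_rank a b) \<le> real (Q ^ s * C)" unfolding C_def by linarith
    also have "\<dots> = real Q ^ s * real C" by simp
    also have "\<dots> \<le> (2 powr G) ^ s * 2 ^ t"
      using Q_le of_nat_mono[OF C_le, where 'a=real] by (intro mult_mono power_mono) simp_all
    also have "\<dots> = 2 powr (real s * G + real t)"
      by (simp add: powr_add powr_power powr_realpow mult.commute)
    also have "\<dots> \<le> 2 powr ((rate + \<epsilon>) * real N + (E + real t))"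
    proof (rule powr_mono)
      have "real s * G \<le> (real N / (real t - K) + 1) * E"
        using s(2) GE G0 by (intro mult_mono) (use s(1) t(2) in auto)
      also have "\<dots> = real N / (real t - K) * E + E" by (simp add: algebra_simps)
      also have "real N / (real t - K) * E \<le> real N / (real t - K) * ((rate + \<epsilon>) * (real t - K))"
        using E t(2) by (intro mult_left_mono) auto
      also have "\<dots> = (rate + \<epsilon>) * real N" using t(2) by simp
      finally show "real s * G + real t \<le> (rate + \<epsilon>) * real N + (E + real t)" by simp
    qed simp
    finally show "real (dome_border_rank a b)
        \<le> 2 powr ((log 2 (real R) - binary_entropy p + \<epsilon>) * real N + (E + real t))"
      by (simp add: rate_def)
  qed
qed

theorem theorem4p3:
  fixes n :: nat and p M :: real
  assumes "n \<ge> 2" and "even n"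
    and "0 < p" and "p < 1"
    and "M = 1 / 4 * real n ^ 3"
  shows "dome_exponent_le ((real n + 1) powr p) (M powr (1 - p))
           (log 2 ((real n + 1) ^ 3 + 1) - binary_entropy p)"
proof -
  obtain h where h: "n = 2 * h" using assms(2) by auto
  define I where "I = insert None (Some ` ({..<h} \<times> (UNIV :: bool set)))"
  define \<Lambda> where "\<Lambda> = {..<h} \<times> {..<h} \<times> {..<h} \<times> (UNIV :: bool set)"
  have I: "finite I" "card I = n + 1"
    by (simp_all add: I_def h card_image card_cartesian_product)
  have \<Lambda>: "finite \<Lambda>" "card \<Lambda> = 2 * h ^ 3"
    by (simp_all add: \<Lambda>_def card_cartesian_product power3_eq_cube)
  have "dome_sum I \<Lambda> \<in> border_le ((n + 1) ^ 3 + 1)"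
    using border_le_dome_sum_cells[of "{..<h}"] by (simp add: I_def \<Lambda>_def h)
  then have "dome_exponent_le (real (card I) powr p) (real (card \<Lambda>) powr (1 - p))
      (log 2 (real ((n + 1) ^ 3 + 1)) - binary_entropy p)"
    by (rule dome_exponent_le_of_dome_sum) (use I \<Lambda> assms h in auto)
  moreover have "real (card \<Lambda>) = M"
    unfolding assms(5) \<Lambda>(2) h by (simp add: power3_eq_cube)
  ultimately show ?thesis by (simp add: I(2) add.commute)
qed

end
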